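(* Write $\Theta_n=\{\phi_1,\dots,\phi_s\}$ and for $k=1,\dots,m$ let $I_k,J_k\subseteq\{1,\dots,s\}$ and $r_k=\frac{\bigvee_{i\in I_k}\phi_i\vee\bigvee_{j\in J_k}\phi_j}{\bigvee_{j\in J_k}\phi_j}$. Then a substitution $\sigma$ rejects each of $r_1,\dots,r_m$ in $S4$ iff there is a set $W$ with $W\subseteq\{\phi_i\in\Theta_n\mid i\in I_k\cup J_k\}$ for every $k=1,\dots,m$, such that the same $\sigma$ rejects each of the rules $r'_k=\frac{\bigvee_{\phi_i\in W}\phi_i}{\bigvee_{j\in J_k}\phi_j}$, $k=1,\dots,m$.
   Context: $S4$ is the normal modal logic with axioms $K$, $T:\Box A\to A$, $4:\Box A\to\Box\Box A$ and necessitation; $\diamond=\neg\Box\neg$. A substitution $\sigma$ rejects a rule $\frac{\alpha}{\beta}$ if $\vdash_{S4}\sigma(\alpha)$ and $\nvdash_{S4}\sigma(\beta)$. Fix variables $p_1,\dots,p_n$; $\alpha^1=\alpha$, $\alpha^0=\neg\alpha$. $\Theta_n$ is the set of all disjuncts $\bigwedge_{i=1}^n p_i^{t(i,0)}\wedge\bigwedge_{i=1}^n(\diamond p_i)^{t(i,1)}$ for functions $t:\{1,\dots,n\}\times\{0,1\}\to\{0,1\}$. *)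

theory Defs
  imports Main "HOL-Library.FuncSet"
begin

datatype fm =
    Var nat
  | Fls
  | Neg fm
  | Conj fm fm
  | Disj fm fm
  | Imp fm fm
  | Box fm

abbreviation Tru :: fm where
  "Tru \<equiv> Neg Fls"

definition Dia :: "fm \<Rightarrow> fm" where
  "Dia A = Neg (Box (Neg A))"

text \<open>Propositional evaluation in which variables and boxed formulas are both atoms.\<close>

primrec pval :: "(fm \<Rightarrow> bool) \<Rightarrow> fm \<Rightarrow> bool" where
  "pval v (Var x) = v (Var x)"
| "pval v Fls = False"
| "pval v (Neg A) = (\<not> pval v A)"
| "pval v (Conj A B) = (pval v A \<and> pval v B)"
| "pval v (Disj A B) = (pval v A \<or> pval v B)"
| "pval v (Imp A B) = (pval v A \<longrightarrow> pval v B)"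
| "pval v (Box A) = v (Box A)"

definition tautology :: "fm \<Rightarrow> bool" where
  "tautology A \<longleftrightarrow> (\<forall>v. pval v A)"

text \<open>The axioms are schemas, so closure under uniform substitution needs no rule of its own.\<close>

inductive S4 :: "fm \<Rightarrow> bool" (\<open>\<turnstile>\<^sub>S\<^sub>4 _\<close> [50] 50) where
  Taut: "tautology A \<Longrightarrow> \<turnstile>\<^sub>S\<^sub>4 A"
| K: "\<turnstile>\<^sub>S\<^sub>4 Imp (Box (Imp A B)) (Imp (Box A) (Box B))"
| T: "\<turnstile>\<^sub>S\<^sub>4 Imp (Box A) A"
| Four: "\<turnstile>\<^sub>S\<^sub>4 Imp (Box A) (Box (Box A))"
| MP: "\<turnstile>\<^sub>S\<^sub>4 Imp A B \<Longrightarrow> \<turnstile>\<^sub>S\<^sub>4 A \<Longrightarrow> \<turnstile>\<^sub>S\<^sub>4 B"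
| Nec: "\<turnstile>\<^sub>S\<^sub>4 A \<Longrightarrow> \<turnstile>\<^sub>S\<^sub>4 Box A"

primrec subst :: "(nat \<Rightarrow> fm) \<Rightarrow> fm \<Rightarrow> fm" where
  "subst \<sigma> (Var x) = \<sigma> x"
| "subst \<sigma> Fls = Fls"
| "subst \<sigma> (Neg A) = Neg (subst \<sigma> A)"
| "subst \<sigma> (Conj A B) = Conj (subst \<sigma> A) (subst \<sigma> B)"
| "subst \<sigma> (Disj A B) = Disj (subst \<sigma> A) (subst \<sigma> B)"
| "subst \<sigma> (Imp A B) = Imp (subst \<sigma> A) (subst \<sigma> B)"
| "subst \<sigma> (Box A) = Box (subst \<sigma> A)"

datatype rule = Rule (premise: fm) (conclusion: fm)

definition rejects :: "(nat \<Rightarrow> fm) \<Rightarrow> rule \<Rightarrow> bool" where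
  "rejects \<sigma> r \<longleftrightarrow>
     (\<turnstile>\<^sub>S\<^sub>4 subst \<sigma> (premise r)) \<and> \<not> (\<turnstile>\<^sub>S\<^sub>4 subst \<sigma> (conclusion r))"

fun Conjs :: "fm list \<Rightarrow> fm" where
  "Conjs [] = Tru"
| "Conjs [A] = A"
| "Conjs (A # B # As) = Conj A (Conjs (B # As))"

fun Disjs :: "fm list \<Rightarrow> fm" where
  "Disjs [] = Fls"
| "Disjs [A] = A"
| "Disjs (A # B # As) = Disj A (Disjs (B # As))"

text \<open>
  The disjunction of the \<open>\<phi> i\<close> for \<open>i\<close> in a set of indices, taken in increasing order of the
  index; it is meaningful for finite index sets only.
\<close>

definition Disj_over :: "(nat \<Rightarrow> fm) \<Rightarrow> nat set \<Rightarrow> fm" where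
  "Disj_over \<phi> I = Disjs (map \<phi> (sorted_list_of_set I))"

text \<open>\<open>signed A e\<close> is \<open>A\<close> to the power \<open>e\<close>, for \<open>e\<close> equal to 0 or 1.\<close>

definition signed :: "fm \<Rightarrow> nat \<Rightarrow> fm" where
  "signed A e = (if e = 1 then A else Neg A)"

text \<open>The variables \<open>p\<^sub>1\<close> to \<open>p\<^sub>n\<close> are \<open>Var 1\<close> to \<open>Var n\<close>.\<close>

definition disjunct :: "nat \<Rightarrow> (nat \<times> nat \<Rightarrow> nat) \<Rightarrow> fm" where
  "disjunct n t =
     Conj (Conjs (map (\<lambda>i. signed (Var i) (t (i, 0))) [1..<Suc n]))
          (Conjs (map (\<lambda>i. signed (Dia (Var i)) (t (i, 1))) [1..<Suc n]))"

definition Theta :: "nat \<Rightarrow> fm set" where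
  "Theta n = {disjunct n t | t. t \<in> {1..n} \<times> {0, 1} \<rightarrow> {0, 1}}"

end

theory Submission
  imports Defs
begin

text \<open>
  Distinct members of \<open>\<Theta>\<^sub>n\<close> disagree on some \<open>p\<^sub>i\<close> or \<open>\<diamond>p\<^sub>i\<close>, so after substitution they still
  exclude each other propositionally. A valuation satisfying all the premises therefore satisfies
  one and the same disjunct in each of them, and hence the disjunction over the
  intersection \<open>W\<close> of the index sets \<open>I\<^sub>k \<union> J\<^sub>k\<close>; thus that disjunction is derivable from the
  premises. Conversely, each premise is weaker than the disjunction over \<open>W\<close>.
\<close>

text \<open>Premises are discharged one at a time: the induction hypothesis is applied to
  \<open>Imp A B\<close>, and \<open>MP\<close> then removes \<open>A\<close>. With no premises
  left, \<open>B\<close> is a tautology. This reduces the derivability claims below to statements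
  about a single valuation \<open>v\<close>.\<close>

lemma S4_propositional_consequence:
  assumes "finite F"
    and "\<And>A. A \<in> F \<Longrightarrow> \<turnstile>\<^sub>S\<^sub>4 A"
    and "\<And>v. (\<And>A. A \<in> F \<Longrightarrow> pval v A) \<Longrightarrow> pval v B"
  shows "\<turnstile>\<^sub>S\<^sub>4 B"
  using assms
proof (induction F arbitrary: B rule: finite_induct)
  case empty
  then show ?case
    by (simp add: S4.Taut tautology_def)
next
  case (insert A F)
  have "\<turnstile>\<^sub>S\<^sub>4 Imp A B"
  proof (rule insert.IH)
    show "\<turnstile>\<^sub>S\<^sub>4 C" if "C \<in> F" for C
      using insert.prems(1) that by simp
    fix v
    assume *: "\<And>C. C \<in> F \<Longrightarrow> pval v C"
    have "pval v B" if "pval v A"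
      by (rule insert.prems(2)) (use * that in \<open>elim insertE, simp_all\<close>)
    then show "pval v (Imp A B)"
      by simp
  qed
  moreover have "\<turnstile>\<^sub>S\<^sub>4 A"
    using insert.prems(1) by simp
  ultimately show ?case
    by (rule S4.MP)
qed

lemma pval_subst_Disjs:
  "pval v (subst \<sigma> (Disjs As)) \<longleftrightarrow> (\<exists>A\<in>set As. pval v (subst \<sigma> A))"
  by (induction As rule: Disjs.induct) auto

lemma pval_subst_Conjs:
  "pval v (subst \<sigma> (Conjs As)) \<longleftrightarrow> (\<forall>A\<in>set As. pval v (subst \<sigma> A))"
  by (induction As rule: Conjs.induct) auto

lemma pval_subst_Disj_over:
  assumes "finite I"
  shows "pval v (subst \<sigma> (Disj_over \<phi> I)) \<longleftrightarrow> (\<exists>i\<in>I. pval v (subst \<sigma> (\<phi> i)))"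
  using assms by (simp add: Disj_over_def pval_subst_Disjs)

text \<open>A valuation satisfying the substituted disjunct fixes every exponent:
  \<open>t (i, 0)\<close> records the truth value of \<open>\<sigma> i\<close>, and
  \<open>t (i, 1)\<close> that of its possibility.\<close>

lemma pval_subst_disjunct:
  "pval v (subst \<sigma> (disjunct n t)) \<longleftrightarrow>
     (\<forall>i\<in>{1..n}. (t (i, 0) = 1 \<longleftrightarrow> pval v (\<sigma> i)) \<and>
                 (t (i, 1) = 1 \<longleftrightarrow> pval v (subst \<sigma> (Dia (Var i)))))"
proof -
  have signed: "pval v (subst \<sigma> (signed A e)) \<longleftrightarrow> (e = 1 \<longleftrightarrow> pval v (subst \<sigma> A))" for A e
    by (simp add: signed_def)
  have interval: "set [1..<Suc n] = {1..n}"
    by auto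
  show ?thesis
    unfolding disjunct_def subst.simps pval.simps pval_subst_Conjs set_map ball_simps(9)
      signed interval
    by blast
qed

text \<open>The functions in \<open>Theta\<close> are unconstrained outside
  \<open>{1..n} \<times> {0, 1}\<close>, so distinct functions may yield the same formula; agreement
  on this domain is enough.\<close>

lemma disjunct_cong:
  assumes "\<And>i e. i \<in> {1..n} \<Longrightarrow> e \<in> {0, 1} \<Longrightarrow> t (i, e) = u (i, e)"
  shows "disjunct n t = disjunct n u"
proof -
  have "map (\<lambda>i. signed (f i) (t (i, e))) [1..<Suc n] =
      map (\<lambda>i. signed (f i) (u (i, e))) [1..<Suc n]" if "e \<in> {0, 1}" for f e
    using assms that by (intro map_cong) auto
  then show ?thesis
    by (simp only: disjunct_def insert_iff simp_thms)
qed

lemma Theta_exclusive: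
  assumes "A \<in> Theta n" "B \<in> Theta n"
    and "pval v (subst \<sigma> A)" "pval v (subst \<sigma> B)"
  shows "A = B"
proof -
  obtain t where t: "A = disjunct n t" "t \<in> {1..n} \<times> {0, 1} \<rightarrow> {0, 1}"
    using assms(1) by (auto simp: Theta_def)
  obtain u where u: "B = disjunct n u" "u \<in> {1..n} \<times> {0, 1} \<rightarrow> {0, 1}"
    using assms(2) by (auto simp: Theta_def)
  have "t (i, e) = u (i, e)" if i: "i \<in> {1..n}" and e: "e \<in> {0, 1}" for i e
  proof -
    \<comment> \<open>Both exponents are read off the same \<open>v\<close>. As they lie in
      \<open>{0, 1}\<close>, agreeing on being 1 makes them equal.\<close>
    have "t (i, e) = 1 \<longleftrightarrow> u (i, e) = 1"
      using assms(3,4) i e unfolding t(1) u(1) pval_subst_disjunct by blast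
    moreover have "t (i, e) \<in> {0, 1}" "u (i, e) \<in> {0, 1}"
      using t(2) u(2) i e by (auto simp: Pi_iff)
    ultimately show ?thesis
      by auto
  qed
  then show ?thesis
    unfolding t(1) u(1) by (rule disjunct_cong)
qed

theorem theorem3p9:
  fixes n s m :: nat
    and \<phi> :: "nat \<Rightarrow> fm"
    and I J :: "nat \<Rightarrow> nat set"
    and \<sigma> :: "nat \<Rightarrow> fm"
  assumes "bij_betw \<phi> {1..s} (Theta n)"
    and "\<forall>k\<in>{1..m}. I k \<subseteq> {1..s} \<and> J k \<subseteq> {1..s}"
  shows "(\<forall>k\<in>{1..m}. rejects \<sigma>
             (Rule (Disj (Disj_over \<phi> (I k)) (Disj_over \<phi> (J k))) (Disj_over \<phi> (J k))))
     \<longleftrightarrow> (\<exists>W. (\<forall>k\<in>{1..m}. W \<subseteq> {\<phi> i | i. i \<in> I k \<union> J k}) \<and>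
            (\<forall>k\<in>{1..m}. rejects \<sigma>
               (Rule (Disj_over \<phi> {i \<in> {1..s}. \<phi> i \<in> W}) (Disj_over \<phi> (J k)))))"
    (is "?L \<longleftrightarrow> ?R")
proof (intro iffI)
  let ?prem = "\<lambda>k. subst \<sigma> (Disj (Disj_over \<phi> (I k)) (Disj_over \<phi> (J k)))"
  have pval_prem: "pval v (?prem k) \<longleftrightarrow> (\<exists>i\<in>I k \<union> J k. pval v (subst \<sigma> (\<phi> i)))"
    if "k \<in> {1..m}" for k v
  proof -
    have "finite (I k)" "finite (J k)"
      using assms(2) that by (meson finite_atLeastAtMost finite_subset)+
    then show ?thesis
      by (auto simp: pval_subst_Disj_over)
  qed
  {
    assume lhs: ?L
    \<comment> \<open>The intersection is taken over indices, so the inclusions required of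
      \<open>W\<close> are immediate.\<close>
    define W where "W = {\<phi> i | i. i \<in> {1..s} \<and> (\<forall>k\<in>{1..m}. i \<in> I k \<union> J k)}"
    have "\<turnstile>\<^sub>S\<^sub>4 subst \<sigma> (Disj_over \<phi> {i \<in> {1..s}. \<phi> i \<in> W})" if k: "k \<in> {1..m}" for k
    proof (rule S4_propositional_consequence)
      show "finite (?prem ` {1..m})"
        by simp
      show "\<turnstile>\<^sub>S\<^sub>4 A" if "A \<in> ?prem ` {1..m}" for A
        using lhs that by (auto simp: rejects_def)
      fix v
      assume "\<And>A. A \<in> ?prem ` {1..m} \<Longrightarrow> pval v A"
      then have sat: "\<exists>j\<in>I l \<union> J l. pval v (subst \<sigma> (\<phi> j))" if "l \<in> {1..m}" for l
        using that unfolding pval_prem[OF that, symmetric] by blast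
      \<comment> \<open>The fixed \<open>k\<close> supplies one true disjunct; its index is now
        shown to lie in every other index set.\<close>
      obtain i where i: "i \<in> I k \<union> J k" "pval v (subst \<sigma> (\<phi> i))"
        using sat[OF k] by blast
      have i_s: "i \<in> {1..s}"
        using assms(2) i(1) k by blast
      have "i \<in> I l \<union> J l" if l: "l \<in> {1..m}" for l
      proof -
        obtain j where j: "j \<in> I l \<union> J l" "pval v (subst \<sigma> (\<phi> j))"
          using sat[OF l] by blast
        have j_s: "j \<in> {1..s}"
          using assms(2) j(1) l by blast
        \<comment> \<open>Two disjuncts true under the same \<open>v\<close> coincide as formulas,
          and injectivity of \<open>\<phi>\<close> carries this over to their indices.\<close>
        have "\<phi> i = \<phi> j"
          using Theta_exclusive i(2) j(2) bij_betwE[OF assms(1)] i_s j_s by blast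
        with bij_betw_imp_inj_on[OF assms(1)] i_s j_s have "i = j"
          by (auto dest: inj_onD)
        with j(1) show ?thesis
          by simp
      qed
      with i_s have "\<phi> i \<in> W"
        unfolding W_def by blast
      with i(2) i_s show "pval v (subst \<sigma> (Disj_over \<phi> {i \<in> {1..s}. \<phi> i \<in> W}))"
        by (subst pval_subst_Disj_over) auto
    qed
    \<comment> \<open>The old and the new rule share their conclusion, so its underivability carries
      over.\<close>
    with lhs have "\<forall>k\<in>{1..m}. rejects \<sigma>
        (Rule (Disj_over \<phi> {i \<in> {1..s}. \<phi> i \<in> W}) (Disj_over \<phi> (J k)))"
      by (simp add: rejects_def)
    moreover have "\<forall>k\<in>{1..m}. W \<subseteq> {\<phi> i | i. i \<in> I k \<union> J k}"
      unfolding W_def by blast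
    ultimately show ?R
      by blast
  }
  {
    assume ?R
    then obtain W where W: "\<forall>k\<in>{1..m}. W \<subseteq> {\<phi> i | i. i \<in> I k \<union> J k}"
      and rej: "\<forall>k\<in>{1..m}. rejects \<sigma>
        (Rule (Disj_over \<phi> {i \<in> {1..s}. \<phi> i \<in> W}) (Disj_over \<phi> (J k)))"
      by blast
    have "\<turnstile>\<^sub>S\<^sub>4 ?prem k" if k: "k \<in> {1..m}" for k
    proof (rule S4_propositional_consequence)
      let ?B = "subst \<sigma> (Disj_over \<phi> {i \<in> {1..s}. \<phi> i \<in> W})"
      show "finite {?B}"
        by simp
      show "\<turnstile>\<^sub>S\<^sub>4 A" if "A \<in> {?B}" for A
        using rej k that by (auto simp: rejects_def)
      fix v
      assume "\<And>A. A \<in> {?B} \<Longrightarrow> pval v A"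
      then have "pval v ?B"
        by blast
      then obtain i where i: "\<phi> i \<in> W" "pval v (subst \<sigma> (\<phi> i))"
        by (auto simp: pval_subst_Disj_over)
      \<comment> \<open>The inclusion for \<open>W\<close> places the true formula, under some index
        \<open>j\<close>, among the disjuncts of premise \<open>k\<close>.\<close>
      then obtain j where "j \<in> I k \<union> J k" "\<phi> i = \<phi> j"
        using W k by blast
      with i(2) show "pval v (?prem k)"
        unfolding pval_prem[OF k] by auto
    qed
    with rej show ?L
      by (simp add: rejects_def)
  }
qed

end
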